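(* Let $r\geq 0$ and $m\geq 1$ be integers, let $n\geq 1$ be an integer, and put $N_r = n+\frac{r}{2}$. Then $$S_m^{(r)}(n) = S_1^{(r)}(n)\,\frac{(-1)^{m-1}}{(r+2)^{\overline{m-1}}}\,\det H_m^{(r)}(N_r),$$ where $H_m^{(r)}(N_r)$ is the $(m-1)\times(m-1)$ lower Hessenberg matrix whose entries $h_{i,k}$ ($1\le i,k\le m-1$) are $$h_{i,k} = \begin{cases} r\binom{i+1}{k} B_{i+1-k}, & k<i,\\ -(i+1)N_r, & k=i,\\ r+i+1, & k=i+1,\\ 0, & k>i+1.\end{cases}$$ Explicitly, its first row is $(-2N_r,\ r+2,\ 0,\dots,0)$, its second row is $(r\binom{3}{1}B_2,\ -3N_r,\ r+3,\ 0,\dots,0)$, and its last row is $(r\binom{m}{1}B_{m-1},\ r\binom{m}{2}B_{m-2},\ \dots,\ r\binom{m}{m-2}B_2,\ -mN_r)$. For $m=1$ the determinant of the empty ($0\times 0$) matrix is taken to be $1$.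
   Context: For integers $m,r\geq 0$ and $n\geq 1$, the hyper-sums of powers of integers are defined recursively by $S_m^{(0)}(n)=n^m$ and $S_m^{(r)}(n)=\sum_{i=1}^n S_m^{(r-1)}(i)$ for $r\geq 1$. (In particular $S_1^{(r)}(n)=\binom{n+r}{r+1}$.) The rising factorial is $x^{\overline{k}}=x(x+1)\cdots(x+k-1)$ with $x^{\overline{0}}=1$. The $B_j$ are the Bernoulli numbers, $B_0=1$, $B_1=-\frac12$, $B_2=\frac16$, $B_3=0,\dots$, given by $\frac{t}{e^t-1}=\sum_{j\ge0}B_j\frac{t^j}{j!}$. *)

theory Defs
  imports
    Complex_Main
    "HOL-Computational_Algebra.Formal_Power_Series"
    "Jordan_Normal_Form.Determinant"
begin

text \<open>\<open>hyper_sum r m n\<close> is $S_m^{(r)}(n)$.\<close>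

fun hyper_sum :: "nat \<Rightarrow> nat \<Rightarrow> nat \<Rightarrow> nat" where
  "hyper_sum 0 m n = n ^ m"
| "hyper_sum (Suc r) m n = (\<Sum>i = 1..n. hyper_sum r m i)"

text \<open>
  The coefficients of the exponential generating function $t / (e^t - 1)$, so that $B_1 = -1/2$.
  Both series have subdegree 1, and power series division cancels the common factor $t$.
\<close>

definition bernoulli :: "nat \<Rightarrow> real" where
  "bernoulli j = fact j * fps_nth (fps_X / (fps_exp 1 - 1)) j"

text \<open>Entry $(i, k)$, with indices starting at 1 and $N$ in place of $N_r$.\<close>

definition hess_entry :: "nat \<Rightarrow> real \<Rightarrow> nat \<Rightarrow> nat \<Rightarrow> real" where
  "hess_entry r N i k =
    (if k < i then real r * real ((i + 1) choose k) * bernoulli (i + 1 - k)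
     else if k = i then - real (i + 1) * N
     else if k = i + 1 then real (r + i + 1)
     else 0)"

text \<open>Matrices are indexed from 0, whence the shift.\<close>

definition hess_mat :: "nat \<Rightarrow> nat \<Rightarrow> real \<Rightarrow> real mat" where
  "hess_mat r m N = mat (m - 1) (m - 1) (\<lambda>(i, k). hess_entry r N (i + 1) (k + 1))"

end

theory Submission
  imports Defs
begin

text \<open>
  For fixed $r$ and $n$ let $A(t) = \sum_m S_m^{(r)}(n) t^m / m!$. Summation over $n$ gives
  $(e^t - 1)(A' - nA) = r(S_0^{(r)}(n) e^t - A)$. Multiplying by $t / (e^t - 1)$ and comparing
  coefficients yields, for $m \ge 2$,
  $m S_m = m n S_{m-1} - r \sum_{k=1}^m \binom{m}{k} B_{m-k} S_k$. Since $B_0 = 1$ and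
  $B_1 = -1/2$, this says that the vector $(S_1, \dots, S_{m-1})$ is mapped by the Hessenberg
  matrix to a multiple of the last unit vector, and Cramer's rule for the first coordinate gives
  the determinant.
\<close>

section \<open>Hessenberg determinants from a kernel vector\<close>

text \<open>
  The last column of the underlying $p \times (p+1)$ system is moved to the right-hand side, which
  then vanishes except in its last entry. Replacing the first column by it leaves, after expansion,
  a triangular minor with the superdiagonal of \<open>f\<close> as its diagonal.
\<close>

lemma det_hessenberg:
  fixes f :: "nat \<Rightarrow> nat \<Rightarrow> 'a :: comm_ring_1" and x :: "nat \<Rightarrow> 'a"
  assumes zero: "\<And>i k. i < p \<Longrightarrow> Suc i < k \<Longrightarrow> f i k = 0"
    and kernel: "\<And>i. i < p \<Longrightarrow> (\<Sum>k\<le>Suc i. f i k * x k) = 0"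
  shows "x 0 * det (mat p p (\<lambda>(i, k). f i k)) = (-1) ^ p * (\<Prod>i<p. f i (Suc i)) * x p"
proof (cases p)
  case 0
  then show ?thesis by simp
next
  case (Suc q)
  define M where "M = mat p p (\<lambda>(i, k). f i k)"
  define v where "v = vec p x"
  define R where "R = replace_col M (M *\<^sub>v v) 0"
  have M: "M \<in> carrier_mat p p" and v: "v \<in> carrier_vec p"
    by (simp_all add: M_def v_def)
  have R: "R \<in> carrier_mat p p"
    using M by (auto simp: R_def replace_col_def)
  \<comment> \<open>A row \<open>i < q\<close> has all its nonzero entries inside the square matrix,
    so its kernel relation survives truncation. Only the last row loses a term,
    \<open>f q p * x p\<close>.\<close>
  have Mv: "(M *\<^sub>v v) $ i = (if i = q then - (f q p * x p) else 0)" if i: "i < p" for i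
  proof -
    have "(M *\<^sub>v v) $ i = (\<Sum>k<p. f i k * x k)"
      using i by (simp add: M_def v_def scalar_prod_def lessThan_atLeast0)
    also have "\<dots> = (if i = q then - (f q p * x p) else 0)"
    proof (cases "i = q")
      case True
      then show ?thesis
        using kernel[OF i] Suc
        by (simp add: lessThan_Suc_atMost eq_neg_iff_add_eq_0)
    next
      case False
      then have "(\<Sum>k<p. f i k * x k) = (\<Sum>k\<le>Suc i. f i k * x k)"
        using i Suc by (intro sum.mono_neutral_right) (auto simp: zero)
      then show ?thesis using kernel[OF i] False by simp
    qed
    finally show ?thesis .
  qed
  have R_0: "R $$ (i, 0) = (if i = q then - (f q p * x p) else 0)" if "i < p" for i
    using that M Mv[OF that] Suc by (simp add: R_def replace_col_def del: index_mult_mat_vec)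
  define L where "L = mat_delete R q 0"
  have L: "L \<in> carrier_mat q q"
    using R Suc by (auto simp: L_def mat_delete_def)
  have L_index: "L $$ (i, j) = f i (Suc j)" if "i < q" "j < q" for i j
    using that Suc M by (simp add: L_def mat_delete_def R_def replace_col_def M_def)
  have "det L = prod_list (diag_mat L)"
    by (rule det_lower_triangular[OF _ L]) (use zero Suc in \<open>auto simp: L_index\<close>)
  also have "\<dots> = (\<Prod>i<q. f i (Suc i))"
    using L by (simp add: prod_list_diag_prod L_index lessThan_atLeast0)
  finally have detL: "det L = (\<Prod>i<q. f i (Suc i))" .
  have "x 0 * det M = det R"
    using cramer_lemma_mat[OF M v, of 0] Suc by (simp add: R_def v_def)
  also have "\<dots> = (\<Sum>i<p. R $$ (i, 0) * cofactor R i 0)"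
    by (rule laplace_expansion_column[OF R]) (simp add: Suc)
  also have "\<dots> = (\<Sum>i<p. if i = q then - (f q p * x p) * cofactor R q 0 else 0)"
    by (intro sum.cong) (auto simp: R_0)
  \<comment> \<open>The minus sign and the cofactor sign \<open>(-1) ^ q\<close> combine to
    \<open>(-1) ^ p\<close>, and \<open>f q p\<close> is the last factor of the superdiagonal
    product.\<close>
  also have "\<dots> = - (f q p * x p) * ((-1) ^ q * (\<Prod>i<q. f i (Suc i)))"
    using Suc by (simp add: cofactor_def detL flip: L_def)
  finally show ?thesis
    by (simp add: M_def Suc)
qed

section \<open>Exponential generating functions of the hyper-sums\<close>

definition hyper_egf :: "nat \<Rightarrow> nat \<Rightarrow> real fps" where
  "hyper_egf r n = Abs_fps (\<lambda>m. real (hyper_sum r m n) / fact m)"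

lemma hyper_egf_nth: "fps_nth (hyper_egf r n) m = real (hyper_sum r m n) / fact m"
  by (simp add: hyper_egf_def)

lemma hyper_egf_0: "hyper_egf 0 n = fps_exp (real n)"
  by (rule fps_ext) (simp add: hyper_egf_nth)

lemma hyper_egf_Suc_0: "hyper_egf (Suc r) 0 = 0"
  by (rule fps_ext) (simp add: hyper_egf_nth)

lemma hyper_egf_Suc_Suc:
  "hyper_egf (Suc r) (Suc n) = hyper_egf (Suc r) n + hyper_egf r (Suc n)"
  by (rule fps_ext) (simp add: hyper_egf_nth add_divide_distrib)

lemma hyper_egf_1: "hyper_egf r 1 = fps_exp 1"
proof (induction r)
  case (Suc r)
  then show ?case
    using hyper_egf_Suc_Suc[of r 0] by (simp add: hyper_egf_Suc_0)
qed (simp add: hyper_egf_0)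

lemma hyper_sum_Suc_Suc: "hyper_sum (Suc r) m (Suc n) = hyper_sum (Suc r) m n + hyper_sum r m (Suc n)"
  by simp

text \<open>For \<open>r = 0\<close> this is the geometric sum of $e^{t}, ..., e^{nt}$. Both sides
  obey the same recursion in \<open>n\<close>, so an inner induction on \<open>n\<close> lifts the
  identity from \<open>r\<close> to \<open>Suc r\<close>. It serves to eliminate the surplus term in
  \<open>hyper_egf_ode\<close>.\<close>

lemma hyper_egf_shift:
  "(fps_exp 1 - 1) * hyper_egf (Suc r) n
     = hyper_egf r (Suc n) - of_nat (hyper_sum r 0 (Suc n)) * fps_exp 1"
proof (induction r arbitrary: n)
  case 0
  show ?case
  proof (induction n)
    case 0
    then show ?case by (simp add: hyper_egf_Suc_0 hyper_egf_0)
  next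
    case (Suc n)
    have "fps_exp (real (Suc (Suc n))) = fps_exp 1 * fps_exp (real (Suc n))"
      by (simp add: fps_exp_add_mult[symmetric])
    then show ?case
      using Suc by (simp add: hyper_egf_Suc_Suc hyper_egf_0 algebra_simps)
  qed
next
  case (Suc r)
  note outer = Suc.IH
  have one: "hyper_sum (Suc r) 0 (Suc 0) = 1" for r
    by (induction r) auto
  show ?case
  proof (induction n)
    case 0
    then show ?case
      using hyper_egf_1[of "Suc r"] one[of r] by (simp add: hyper_egf_Suc_0)
  next
    case (Suc n)
    have "(fps_exp 1 - 1) * hyper_egf (Suc (Suc r)) (Suc n)
        = (fps_exp 1 - 1) * hyper_egf (Suc (Suc r)) n + (fps_exp 1 - 1) * hyper_egf (Suc r) (Suc n)"
      by (simp add: hyper_egf_Suc_Suc[of "Suc r"] algebra_simps)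
    also have "\<dots> = hyper_egf (Suc r) (Suc n) + hyper_egf r (Suc (Suc n))
        - of_nat (hyper_sum (Suc r) 0 (Suc n) + hyper_sum r 0 (Suc (Suc n))) * fps_exp 1"
      unfolding Suc.IH outer by (simp only: of_nat_add) (simp add: algebra_simps)
    finally show ?case
      by (simp only: hyper_egf_Suc_Suc[of r "Suc n"] hyper_sum_Suc_Suc[of r 0 "Suc n"])
  qed
qed

text \<open>For \<open>r = 0\<close> both sides vanish. When \<open>n\<close> grows by one, the
  factor \<open>Suc n\<close> on the old series leaves a surplus $-(e^t - 1) A$. By
  \<open>hyper_egf_shift\<close> this is one further copy of the contribution of
  \<open>hyper_egf r (Suc n)\<close>, which turns its factor \<open>r\<close> into
  \<open>Suc r\<close>.\<close>

lemma hyper_egf_ode: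
  "(fps_exp 1 - 1) * (fps_deriv (hyper_egf r n) - of_nat n * hyper_egf r n)
     = of_nat r * (of_nat (hyper_sum r 0 n) * fps_exp 1 - hyper_egf r n)"
proof (induction r arbitrary: n)
  case 0
  then show ?case by (simp add: hyper_egf_0 fps_of_nat[symmetric])
next
  case (Suc r)
  note outer = Suc.IH
  show ?case
  proof (induction n)
    case 0
    then show ?case by (simp add: hyper_egf_Suc_0)
  next
    case (Suc n)
    let ?E = "fps_exp 1 :: real fps"
    let ?A = "hyper_egf (Suc r) n" and ?B = "hyper_egf r (Suc n)"
    let ?a = "of_nat (hyper_sum (Suc r) 0 n) :: real fps"
    let ?b = "of_nat (hyper_sum r 0 (Suc n)) :: real fps"
    have "(?E - 1) * (fps_deriv (?A + ?B) - of_nat (Suc n) * (?A + ?B))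
        = (?E - 1) * (fps_deriv ?A - of_nat n * ?A)
          + (?E - 1) * (fps_deriv ?B - of_nat (Suc n) * ?B) - (?E - 1) * ?A"
      by (simp add: algebra_simps)
    also have "\<dots> = of_nat (Suc r) * ((?a + ?b) * ?E - (?A + ?B))"
      unfolding Suc.IH outer hyper_egf_shift by (simp add: algebra_simps)
    finally show ?case
      by (simp only: hyper_egf_Suc_Suc[of r n] hyper_sum_Suc_Suc[of r 0 n] of_nat_add)
  qed
qed

section \<open>Bernoulli numbers and the recurrence in the exponent\<close>

definition bernoulli_fps :: "real fps" where
  "bernoulli_fps = fps_X / (fps_exp 1 - 1)"

lemma bernoulli_fps_nth: "fps_nth bernoulli_fps j = bernoulli j / fact j"
  by (simp add: bernoulli_fps_def bernoulli_def)

lemma fps_exp_minus_1_nonzero: "fps_exp 1 - 1 \<noteq> (0 :: real fps)"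
proof
  assume "fps_exp 1 - 1 = (0 :: real fps)"
  then have "fps_nth (fps_exp 1 - 1 :: real fps) 1 = 0" by simp
  then show False by simp
qed

lemma bernoulli_fps_mult: "bernoulli_fps * (fps_exp 1 - 1) = fps_X"
proof -
  have "subdegree (fps_exp 1 - 1 :: real fps) = 1"
    by (rule subdegreeI) auto
  then show ?thesis
    unfolding bernoulli_fps_def
    by (intro fps_times_divide_eq) (auto simp: fps_exp_minus_1_nonzero)
qed

lemma bernoulli_0: "bernoulli 0 = 1"
  and bernoulli_1: "bernoulli 1 = - 1 / 2"
proof -
  have 1: "fps_nth (bernoulli_fps * (fps_exp 1 - 1)) 1 = fps_nth fps_X 1"
   and 2: "fps_nth (bernoulli_fps * (fps_exp 1 - 1)) 2 = fps_nth fps_X 2"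
    by (simp_all add: bernoulli_fps_mult)
  from 1 show "bernoulli 0 = 1"
    by (simp add: fps_mult_nth bernoulli_fps_nth)
  with 2 show "bernoulli 1 = - 1 / 2"
    by (simp add: fps_mult_nth bernoulli_fps_nth numeral_2_eq_2)
qed

text \<open>Writing $a e^t - A = a (e^t - 1) - (A - a)$ in \<open>hyper_egf_ode\<close> confines the
  Bernoulli series to \<open>A - a\<close>, which has no constant term. The part $a (e^t - 1)$
  becomes a multiple of \<open>fps_X\<close>, which affects degree 1 only; hence
  \<open>m \<ge> 2\<close> in \<open>hyper_sum_recurrence\<close>.\<close>

lemma hyper_egf_bernoulli:
  fixes r n :: nat
  defines "a \<equiv> of_nat (hyper_sum r 0 n)"
  shows "fps_X * fps_deriv (hyper_egf r n) = of_nat n * (fps_X * hyper_egf r n)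
     - of_nat r * (bernoulli_fps * (hyper_egf r n - a)) + of_nat r * a * fps_X"
    (is "?l = ?r")
proof -
  let ?D = "fps_exp 1 - 1 :: real fps" and ?A = "hyper_egf r n"
  have E: "fps_exp 1 = ?D + (1 :: real fps)" by simp
  have "?D * ?l = fps_X * (?D * (fps_deriv ?A - of_nat n * ?A)) + ?D * (of_nat n * (fps_X * ?A))"
    by (simp add: algebra_simps)
  also have "\<dots> = fps_X * (of_nat r * (a * ?D - (?A - a))) + ?D * (of_nat n * (fps_X * ?A))"
    unfolding hyper_egf_ode a_def by (simp add: algebra_simps)
  also have "\<dots> = ?D * ?r + of_nat r * (bernoulli_fps * ?D - fps_X) * (?A - a)"
    by (simp add: algebra_simps)
  finally have "?D * ?l = ?D * ?r" by (simp add: bernoulli_fps_mult)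
  then show ?thesis using fps_exp_minus_1_nonzero by (metis mult_left_cancel)
qed

lemma hyper_sum_recurrence:
  assumes "m \<ge> 2"
  shows "real m * hyper_sum r m n = real m * real n * hyper_sum r (m - 1) n
     - real r * (\<Sum>k = 1..m. real (m choose k) * bernoulli (m - k) * hyper_sum r k n)"
proof -
  let ?A = "hyper_egf r n"
  let ?a = "of_nat (hyper_sum r 0 n) :: real fps"
  have coeff: "fps_nth (bernoulli_fps * (?A - ?a)) m
      = (\<Sum>k = 1..m. real (m choose k) * bernoulli (m - k) * hyper_sum r k n) / fact m"
  proof -
    have "fps_nth (bernoulli_fps * (?A - ?a)) m = (\<Sum>k = 0..m. fps_nth (?A - ?a) k * fps_nth bernoulli_fps (m - k))"
      by (subst mult.commute) (simp add: fps_mult_nth)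
    \<comment> \<open>The term for \<open>k = 0\<close> drops out because
      \<open>hyper_sum r 0 n\<close> is the constant term of the series.\<close>
    also have "\<dots> = (\<Sum>k = 1..m. fps_nth (?A - ?a) k * fps_nth bernoulli_fps (m - k))"
      by (intro sum.mono_neutral_right)
        (auto simp: hyper_egf_nth fps_of_nat[symmetric] Suc_le_eq)
    also have "\<dots> = (\<Sum>k = 1..m. real (m choose k) * bernoulli (m - k) * hyper_sum r k n / fact m)"
      by (intro sum.cong refl)
        (auto simp: hyper_egf_nth bernoulli_fps_nth fps_of_nat[symmetric] binomial_fact field_simps)
    finally show ?thesis by (simp add: sum_divide_distrib)
  qed
  have "fps_nth (fps_X * fps_deriv ?A) m = fps_nth (of_nat n * (fps_X * ?A)
     - of_nat r * (bernoulli_fps * (?A - ?a)) + of_nat r * ?a * fps_X) m"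
    by (simp only: hyper_egf_bernoulli)
  then have "real m * (hyper_sum r m n / fact m) = real n * (hyper_sum r (m - 1) n / fact (m - 1))
      - real r * ((\<Sum>k = 1..m. real (m choose k) * bernoulli (m - k) * hyper_sum r k n) / fact m)"
    using assms
    by (simp add: coeff[folded fps_of_nat] hyper_egf_nth fps_of_nat[symmetric] mult.assoc)
  moreover have "real n * (hyper_sum r (m - 1) n / fact (m - 1))
      = real m * real n * hyper_sum r (m - 1) n / fact m"
    using assms fact_reduce[of m, where 'a = real] by simp
  ultimately have "real m * hyper_sum r m n / fact m = (real m * real n * hyper_sum r (m - 1) n
     - real r * (\<Sum>k = 1..m. real (m choose k) * bernoulli (m - k) * hyper_sum r k n)) / fact m"
    by (simp add: diff_divide_distrib)
  then show ?thesis by (simp only: divide_cancel_right) simp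
qed

text \<open>This is \<open>hyper_sum_recurrence\<close> at \<open>m = i + 2\<close> with all terms
  on one side. The Bernoulli terms for \<open>k = m\<close> and \<open>k = m - 1\<close> merge with
  the others: $B_0 = 1$ gives the superdiagonal entry $r + m$, and $B_1 = -1/2$ turns $-mn$ into
  $-m(n + r/2)$, which explains the shift in \<open>N\<close>.\<close>

lemma hess_entry_kernel:
  fixes r n i :: nat
  defines "N \<equiv> real n + real r / 2"
  shows "(\<Sum>k\<le>Suc i. hess_entry r N (Suc i) (Suc k) * hyper_sum r (Suc k) n) = 0"
proof -
  let ?a = "\<lambda>k. real (hyper_sum r k n)"
  let ?t = "\<lambda>k. real (Suc (Suc i) choose k) * bernoulli (Suc (Suc i) - k) * ?a k"
  have "(\<Sum>k\<le>Suc i. hess_entry r N (Suc i) (Suc k) * ?a (Suc k))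
      = (\<Sum>k<i. real r * ?t (Suc k))
        - real (i + 2) * N * ?a (Suc i) + real (r + i + 2) * ?a (i + 2)"
    by (simp add: hess_entry_def lessThan_Suc_atMost[symmetric] algebra_simps)
  also have "(\<Sum>k<i. real r * ?t (Suc k)) = real r * (\<Sum>k = 1..i. ?t k)"
    unfolding sum_distrib_left
    by (rule sum.reindex_bij_witness[of _ "\<lambda>k. k - 1" Suc]) auto
  also have "(\<Sum>k = 1..i. ?t k)
      = (\<Sum>k = 1..i + 2. ?t k) + real (i + 2) / 2 * ?a (Suc i) - ?a (i + 2)"
    using bernoulli_1 by (simp add: bernoulli_0)
  finally show ?thesis
    using hyper_sum_recurrence[of "i + 2" r n]
    by (simp add: N_def algebra_simps)
qed

theorem theorem4:
  fixes r m n :: nat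
  assumes "m \<ge> 1" and "n \<ge> 1"
  shows "real (hyper_sum r m n) =
    real (hyper_sum r 1 n) * ((-1) ^ (m - 1) / pochhammer (real (r + 2)) (m - 1))
      * det (hess_mat r m (real n + real r / 2))"
proof -
  define p where "p = m - 1"
  let ?N = "real n + real r / 2"
  \<comment> \<open>The kernel vector starts at $S_1$, so its entry at index \<open>p\<close>, just
    outside the square matrix, is $S_m$. The superdiagonal $r + 2, ..., r + m$ multiplies to the
    rising factorial.\<close>
  have "real (hyper_sum r (Suc 0) n) * det (mat p p (\<lambda>(i, k). hess_entry r ?N (Suc i) (Suc k)))
      = (-1) ^ p * (\<Prod>i<p. hess_entry r ?N (Suc i) (Suc (Suc i))) * real (hyper_sum r (Suc p) n)"
    by (rule det_hessenberg[where x = "\<lambda>k. real (hyper_sum r (Suc k) n)"])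
      (simp_all add: hess_entry_kernel del: sum.atMost_Suc, simp add: hess_entry_def)
  also have "(\<Prod>i<p. hess_entry r ?N (Suc i) (Suc (Suc i))) = pochhammer (real (r + 2)) p"
    by (simp add: hess_entry_def pochhammer_prod lessThan_atLeast0 add_ac)
  finally have "real (hyper_sum r 1 n) * det (hess_mat r m ?N)
      = (-1) ^ p * pochhammer (real (r + 2)) p * real (hyper_sum r m n)"
    using assms by (simp add: hess_mat_def p_def)
  moreover have "pochhammer (real (r + 2)) p \<noteq> 0"
    by (rule less_imp_neq[symmetric, OF pochhammer_pos]) simp
  ultimately show ?thesis
    unfolding p_def[symmetric] by (simp add: field_simps)
qed

end
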